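(* Let $\Omega\subset\mathbb{R}^2$ be decomposed into non-overlapping elements $D^1,\dots,D^{N_h}$, let $N\ge 0$ be a polynomial degree, and let merge neighborhoods $M_1,\dots,M_{N_h}\subseteq\{1,\dots,N_h\}$ with $k\in M_k$ for every $k$ be given. Let $S$ be the associated state redistribution operator, i.e. the linear operator defined elementwise by $$ (Su)|_{D^k} = \frac{1}{|C_k|}\sum_{j\in C_k} (\Pi_j u)|_{D^k},\qquad k=1,\dots,N_h, $$ where $C_k=\{j : k\in M_j\}$ and $\Pi_j$ is the weighted $L_2$ projection over the merge neighborhood $M_j$ (defined in the context). Then for every $u\in L_2(\Omega)$, $$ \| S u\|_{L_2(\Omega)} \le \|u\|_{L_2(\Omega)}, $$ that is, $S$ is contractive in the $L_2$ norm.
   Context: Setting: $\Omega\subset\mathbb{R}^2$ is a bounded domain with $\Omega=\bigcup_{k=1}^{N_h}D^k$, where the elements $D^k$ (Cartesian rectangles or cut cells of arbitrary shape) have positive measure and are non-overlapping, meaning that distinct elements intersect only in sets of measure zero. Merge neighborhoods: to each element index $k$ is associated a set of element indices $M_k=\{k,k_1,k_2,\dots\}\subseteq\{1,\dots,N_h\}$ containing $k$, called the merge neighborhood of $D^k$; for elements that do not require merging, $M_k=\{k\}$. An element may belong to several merge neighborhoods. Set $C_k=\{j : k\in M_j\}$, the set of (indices of) merge neighborhoods to which $D^k$ contributes, and let $|C_k|$ denote its cardinality (so $|C_k|\ge 1$ since $k\in C_k$). Weighted inner product: write $D^{M_k}$ for the union of the elements $D^j$, $j\in M_k$. For functions $u,v$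 on $D^{M_k}$ define $$ (u,v)_{M_k}=\sum_{j\in M_k}\frac{1}{|C_j|}\,(u,v)_{L_2(D^j)}, $$ where $(u,v)_{L_2(D^j)}=\int_{D^j}uv$. Projection: $\mathbb{P}^N(D^{M_k})$ denotes the space of (single) polynomials in $(x,y)$ of total degree at most $N$ restricted to $D^{M_k}$. For a function $u$ on $\Omega$, $\Pi_k u\in\mathbb{P}^N(D^{M_k})$ is the projection determined by $$ (\Pi_k u,v)_{M_k}=(u,v)_{M_k}\qquad\text{for all } v\in\mathbb{P}^N(D^{M_k}). $$ Functions are real-valued, and $\|\cdot\|_{L_2(\Omega)}$ is the usual $L_2$ norm. *)

theory Defs
  imports "HOL-Analysis.Analysis"
begin

type_synonym plane = "real \<times> real"

definition L2 :: "plane set \<Rightarrow> (plane \<Rightarrow> real) set" where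
  "L2 A = {u. u \<in> borel_measurable (lebesgue_on A) \<and>
              integrable (lebesgue_on A) (\<lambda>x. (u x)\<^sup>2)}"

definition L2_inner :: "plane set \<Rightarrow> (plane \<Rightarrow> real) \<Rightarrow> (plane \<Rightarrow> real) \<Rightarrow> real" where
  "L2_inner A u v = (LINT x|lebesgue_on A. u x * v x)"

definition L2_norm :: "plane set \<Rightarrow> (plane \<Rightarrow> real) \<Rightarrow> real" where
  "L2_norm A u = sqrt (L2_inner A u u)"

text \<open>
  A mesh is given by the number \<open>n\<close> of elements, the elements \<open>D 1, \<dots>, D n\<close> and the merge
  neighborhoods \<open>M 1, \<dots>, M n\<close>; the values of \<open>D\<close> and \<open>M\<close> at other indices are never used.

  The covering of \<open>\<Omega>\<close> by the elements is required, like their non-overlapping, only up to null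
  sets, so that besides the case \<open>\<Omega> = (\<Union>k\<in>{1..n}. D k)\<close> the elements of an open \<open>\<Omega>\<close> may also
  be taken all closed or all open.
\<close>

definition decomposition :: "plane set \<Rightarrow> nat \<Rightarrow> (nat \<Rightarrow> plane set) \<Rightarrow> bool" where
  "decomposition \<Omega> n D \<longleftrightarrow>
     (\<forall>k\<in>{1..n}. D k \<in> sets lebesgue \<and> emeasure lebesgue (D k) > 0) \<and>
     (\<forall>j\<in>{1..n}. \<forall>k\<in>{1..n}. j \<noteq> k \<longrightarrow> D j \<inter> D k \<in> null_sets lebesgue) \<and>
     sym_diff \<Omega> (\<Union>k\<in>{1..n}. D k) \<in> null_sets lebesgue"

definition merge_neighborhoods :: "nat \<Rightarrow> (nat \<Rightarrow> nat set) \<Rightarrow> bool" where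
  "merge_neighborhoods n M \<longleftrightarrow> (\<forall>k\<in>{1..n}. k \<in> M k \<and> M k \<subseteq> {1..n})"

definition contributions :: "nat \<Rightarrow> (nat \<Rightarrow> nat set) \<Rightarrow> nat \<Rightarrow> nat set" where
  "contributions n M k = {j \<in> {1..n}. k \<in> M j}"

definition merged :: "(nat \<Rightarrow> plane set) \<Rightarrow> (nat \<Rightarrow> nat set) \<Rightarrow> nat \<Rightarrow> plane set" where
  "merged D M k = (\<Union>j\<in>M k. D j)"

definition weighted_inner ::
  "nat \<Rightarrow> (nat \<Rightarrow> plane set) \<Rightarrow> (nat \<Rightarrow> nat set) \<Rightarrow> nat \<Rightarrow>
   (plane \<Rightarrow> real) \<Rightarrow> (plane \<Rightarrow> real) \<Rightarrow> real" where
  "weighted_inner n D M k u v =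
     (\<Sum>j\<in>M k. 1 / real (card (contributions n M j)) * L2_inner (D j) u v)"

definition poly_fun :: "nat \<Rightarrow> (nat \<Rightarrow> nat \<Rightarrow> real) \<Rightarrow> plane \<Rightarrow> real" where
  "poly_fun N c = (\<lambda>(x, y). \<Sum>(a, b)\<in>{(a, b). a + b \<le> N}. c a b * x ^ a * y ^ b)"

definition poly_space :: "nat \<Rightarrow> plane set \<Rightarrow> (plane \<Rightarrow> real) set" where
  "poly_space N A = {restrict (poly_fun N c) A | c. True}"

text \<open>
  The description is proper for \<open>u \<in> L2 \<Omega>\<close>: the weighted form is definite on the
  finite-dimensional space \<open>poly_space N (merged D M k)\<close>, since the elements have positive
  measure and the zero set of a nonzero polynomial is a null set.
\<close>

definition merge_projection ::
  "nat \<Rightarrow> nat \<Rightarrow> (nat \<Rightarrow> plane set) \<Rightarrow> (nat \<Rightarrow> nat set) \<Rightarrow> nat \<Rightarrow>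
   (plane \<Rightarrow> real) \<Rightarrow> plane \<Rightarrow> real" where
  "merge_projection N n D M k u =
     (THE p. p \<in> poly_space N (merged D M k) \<and>
        (\<forall>v\<in>poly_space N (merged D M k).
           weighted_inner n D M k p v = weighted_inner n D M k u v))"

definition redistributed ::
  "nat \<Rightarrow> nat \<Rightarrow> (nat \<Rightarrow> plane set) \<Rightarrow> (nat \<Rightarrow> nat set) \<Rightarrow> nat \<Rightarrow>
   (plane \<Rightarrow> real) \<Rightarrow> plane \<Rightarrow> real" where
  "redistributed N n D M k u x =
     1 / real (card (contributions n M k)) *
       (\<Sum>j\<in>contributions n M k. merge_projection N n D M j u x)"

text \<open>
  The elementwise values are glued with indicator functions. On the null set where elements
  overlap the elementwise prescriptions compete and the sum below is just one representative;
  \<open>state_redistribution_on_element\<close> shows that it has the prescribed restriction to each element.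
\<close>

definition state_redistribution ::
  "nat \<Rightarrow> nat \<Rightarrow> (nat \<Rightarrow> plane set) \<Rightarrow> (nat \<Rightarrow> nat set) \<Rightarrow>
   (plane \<Rightarrow> real) \<Rightarrow> plane \<Rightarrow> real" where
  "state_redistribution N n D M u x =
     (\<Sum>k\<in>{1..n}. indicator (D k) x * redistributed N n D M k u x)"

lemma state_redistribution_on_element:
  assumes dec: "decomposition \<Omega> n D" and k: "k \<in> {1..n}"
  shows "AE x in lebesgue_on (D k).
           state_redistribution N n D M u x = redistributed N n D M k u x"
proof -
  have meas: "D k \<in> sets lebesgue"
    using dec k by (auto simp: decomposition_def)
  let ?Z = "\<Union>j\<in>{1..n} - {k}. D j \<inter> D k"
  have "?Z \<in> null_sets lebesgue"
    using dec k by (intro null_sets.finite_UN) (auto simp: decomposition_def)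
  then have "AE x in lebesgue. x \<notin> ?Z"
    by (rule AE_not_in)
  then have "AE x in lebesgue. x \<in> D k \<longrightarrow>
      state_redistribution N n D M u x = redistributed N n D M k u x"
  proof eventually_elim
    case (elim x)
    show ?case
    proof
      assume x: "x \<in> D k"
      have "state_redistribution N n D M u x =
          (\<Sum>j\<in>{1..n}. if j = k then redistributed N n D M k u x else 0)"
        unfolding state_redistribution_def
        using elim x by (intro sum.cong) (auto simp: indicator_def)
      then show "state_redistribution N n D M u x = redistributed N n D M k u x"
        using k by simp
    qed
  qed
  then show ?thesis
    using meas by (simp add: AE_restrict_space_iff)
qed

end

theory Submission imports Defs
begin

text \<open>
  Each projection \<open>\<Pi>\<^sub>j\<close> is orthogonal for the form \<open>(\<cdot>, \<cdot>)\<^bsub>M\<^sub>j\<^esub>\<close> and hence does not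
  increase the corresponding seminorm (\<open>merge_projection_contractive\<close>). Writing \<open>S u\<close> on
  \<open>D\<^sub>k\<close> as the mean of the \<open>|C\<^sub>k|\<close> functions \<open>\<Pi>\<^sub>j u\<close>, \<open>j \<in> C\<^sub>k\<close>, convexity of the
  square bounds \<open>\<parallel>S u\<parallel>\<^sup>2\<close> by the double sum of \<open>\<parallel>\<Pi>\<^sub>j u\<parallel>\<^sup>2 / |C\<^sub>k|\<close> over \<open>D\<^sub>k\<close>, taken over
  all \<open>k\<close> and all \<open>j \<in> C\<^sub>k\<close>. Since \<open>j \<in> C\<^sub>k\<close> means \<open>k \<in> M\<^sub>j\<close>, exchanging the summations turns it into
  the sum over \<open>j\<close> of the squared weighted seminorms of \<open>\<Pi>\<^sub>j u\<close> (\<open>sum_weighted_inner_eq\<close>):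
  the weights \<open>1 / |C\<^sub>k|\<close> are exactly those produced by averaging. Drop the projections, and
  exchange back: \<open>\<parallel>u\<parallel>\<^sup>2\<close> on \<open>D\<^sub>k\<close> is then counted \<open>|C\<^sub>k|\<close> times with weight
  \<open>1 / |C\<^sub>k|\<close>, and the total is \<open>\<parallel>u\<parallel>\<^sup>2\<close> on \<open>\<Omega>\<close>.

  The remaining work is to show that the projections, given by a definite description, exist and
  are unique, even pointwise. Existence comes from a Gram--Schmidt argument on the monomials
  (\<open>projection_onto_span_exists\<close>). Uniqueness needs that
  the form is definite on polynomials (\<open>weighted_inner_poly_fun_definite\<close>), because a nonzero
  polynomial vanishes only on a null set (\<open>null_sets_poly_fun_zeros\<close>) while elements have
  positive measure. The elements may be unbounded, but only through a null set; all integrability is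
  therefore transferred from the bounded set \<open>\<Omega>\<close> (\<open>L2_almost_subset\<close>).
\<close>

section \<open>Semi-inner products and projection onto a finite span\<close>

text \<open>
  The carrier \<open>V\<close> is explicit since bilinearity of an integral form holds only for square-integrable
  functions. The forms are only semidefinite since they vanish on functions that are zero almost
  everywhere.
\<close>

locale semi_inner_space =
  fixes V :: "('a \<Rightarrow> real) set" and B :: "('a \<Rightarrow> real) \<Rightarrow> ('a \<Rightarrow> real) \<Rightarrow> real"
  assumes add_closed: "f \<in> V \<Longrightarrow> g \<in> V \<Longrightarrow> (\<lambda>x. f x + g x) \<in> V"
    and scale_closed: "f \<in> V \<Longrightarrow> (\<lambda>x. a * f x) \<in> V"
    and zero_closed: "(\<lambda>x. 0) \<in> V"
    and commute: "B f g = B g f"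
    and add_left: "f \<in> V \<Longrightarrow> g \<in> V \<Longrightarrow> h \<in> V \<Longrightarrow> B (\<lambda>x. f x + g x) h = B f h + B g h"
    and scale_left: "B (\<lambda>x. a * f x) h = a * B f h"
    and nonneg: "B f f \<ge> 0"
begin

lemma add_right: "f \<in> V \<Longrightarrow> g \<in> V \<Longrightarrow> h \<in> V \<Longrightarrow> B h (\<lambda>x. f x + g x) = B h f + B h g"
  using add_left commute by metis

lemma scale_right: "B h (\<lambda>x. a * f x) = a * B h f"
  using scale_left commute by metis

lemma zero_left: "B (\<lambda>x. 0) h = 0"
  using scale_left[of 0 "\<lambda>x. 0" h] by simp

lemma sum_closed: "(\<And>i. i \<in> I \<Longrightarrow> f i \<in> V) \<Longrightarrow> (\<lambda>x. \<Sum>i\<in>I. f i x) \<in> V"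
  by (induction I rule: infinite_finite_induct) (auto intro: add_closed zero_closed)

lemma sum_left:
  "(\<And>i. i \<in> I \<Longrightarrow> f i \<in> V) \<Longrightarrow> h \<in> V \<Longrightarrow> B (\<lambda>x. \<Sum>i\<in>I. f i x) h = (\<Sum>i\<in>I. B (f i) h)"
  by (induction I rule: infinite_finite_induct) (auto simp: zero_left add_left sum_closed)

lemma diff_closed: "f \<in> V \<Longrightarrow> g \<in> V \<Longrightarrow> (\<lambda>x. f x - g x) \<in> V"
  using add_closed[of f "\<lambda>x. -1 * g x"] scale_closed[of g "-1"] by simp

lemma diff_left: "f \<in> V \<Longrightarrow> g \<in> V \<Longrightarrow> h \<in> V \<Longrightarrow> B (\<lambda>x. f x - g x) h = B f h - B g h"
  using add_left[of f "\<lambda>x. -1 * g x" h] scale_closed[of g "-1"] scale_left[of "-1" g h] by simp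

lemma diff_right: "f \<in> V \<Longrightarrow> g \<in> V \<Longrightarrow> h \<in> V \<Longrightarrow> B h (\<lambda>x. f x - g x) = B h f - B h g"
  using diff_left commute by metis

lemma diff_square:
  "f \<in> V \<Longrightarrow> g \<in> V \<Longrightarrow> B (\<lambda>x. f x - g x) (\<lambda>x. f x - g x) = B f f - 2 * B f g + B g g"
  by (simp add: diff_left diff_right diff_closed commute[of g f])

text \<open>
  Otherwise \<open>B (w - t g) (w - t g) = B w w - 2 t B g w\<close> would be a nonconstant affine function of
  \<open>t\<close> and so take negative values.
\<close>

lemma null_vector_orthogonal:
  assumes g: "g \<in> V" and w: "w \<in> V" and "B g g = 0"
  shows "B g w = 0"
proof (rule ccontr)
  assume ne: "B g w \<noteq> 0"
  \<comment> \<open>the parameter at which the affine function has the value \<open>-1\<close>\<close>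
  define t where "t = (B w w + 1) / (2 * B g w)"
  have "B (\<lambda>x. w x - t * g x) (\<lambda>x. w x - t * g x) = B w w - 2 * t * B g w"
    using diff_square[OF w scale_closed[OF g]] assms(3)
    by (simp add: scale_left scale_right commute[of w g])
  also have "\<dots> = -1"
    using ne by (simp add: t_def field_simps)
  finally show False
    using nonneg[of "\<lambda>x. w x - t * g x"] by simp
qed

text \<open>
  A Gram--Schmidt induction: a new vector \<open>f a\<close> is replaced by its component \<open>g\<close> orthogonal to
  the earlier span, and the projection is corrected by a multiple of \<open>g\<close>. If \<open>g\<close> is a null vector,
  it is orthogonal to everything and the earlier projection already works.
\<close>

lemma projection_onto_span_exists:
  assumes "finite I" and "\<And>i. i \<in> I \<Longrightarrow> f i \<in> V" and "u \<in> V"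
  shows "\<exists>c. \<forall>j\<in>I. B (\<lambda>x. \<Sum>i\<in>I. c i * f i x) (f j) = B u (f j)"
  using assms
proof (induction I arbitrary: u rule: finite_induct)
  case empty
  then show ?case by simp
next
  case (insert a I)
  have fI: "\<And>i. i \<in> I \<Longrightarrow> f i \<in> V" and fa: "f a \<in> V"
    using insert.prems by auto
  obtain c where c: "\<forall>j\<in>I. B (\<lambda>x. \<Sum>i\<in>I. c i * f i x) (f j) = B u (f j)"
    using insert.IH[of u] insert.prems by auto
  obtain d where d: "\<forall>j\<in>I. B (\<lambda>x. \<Sum>i\<in>I. d i * f i x) (f j) = B (f a) (f j)"
    using insert.IH[of "f a"] insert.prems by auto
  define p where "p = (\<lambda>x. \<Sum>i\<in>I. c i * f i x)"
  define q where "q = (\<lambda>x. \<Sum>i\<in>I. d i * f i x)"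
  define g where "g = (\<lambda>x. f a x - q x)"
  have uV: "u \<in> V" using insert.prems by simp
  have pV: "p \<in> V" and qV: "q \<in> V"
    unfolding p_def q_def using fI by (auto intro!: sum_closed scale_closed)
  have gV: "g \<in> V"
    unfolding g_def by (intro diff_closed fa qV)
  \<comment> \<open>If \<open>g\<close> is a null vector the coefficient is \<open>0\<close>, by division by zero.\<close>
  define t where "t = (B u g - B p g) / B g g"
  define r where "r = (\<lambda>x. p x + t * g x)"
  have rV: "r \<in> V"
    unfolding r_def by (intro add_closed scale_closed pV gV)
  have gI: "B g (f j) = 0" if "j \<in> I" for j
    using that d fI unfolding g_def
    by (subst diff_left) (auto simp: fa qV q_def[symmetric])
  have rI: "B r (f j) = B u (f j)" if "j \<in> I" for j
    using that c fI gI unfolding r_def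
    by (subst add_left) (auto simp: pV gV scale_closed scale_left p_def[symmetric])
  have rg: "B r g = B u g"
  proof (cases "B g g = 0")
    case True
    then have "B g r = 0" "B g u = 0"
      using null_vector_orthogonal gV rV uV by blast+
    then show ?thesis by (simp add: commute)
  next
    case False
    have "B r g = B p g + t * B g g"
      unfolding r_def by (subst add_left) (auto simp: pV gV scale_closed scale_left)
    then show ?thesis using False by (simp add: t_def)
  qed
  have q_sum: "B w q = (\<Sum>i\<in>I. d i * B w (f i))" if "w \<in> V" for w
    using sum_left[of I "\<lambda>i x. d i * f i x" w] that fI
    unfolding q_def by (simp add: commute[of w] scale_closed scale_left)
  have rq: "B r q = B u q"
    using rI by (simp add: q_sum rV uV)
  have fa_eq: "f a = (\<lambda>x. g x + q x)"
    by (auto simp: g_def)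
  have ra: "B r (f a) = B u (f a)"
    unfolding fa_eq using rg rq by (simp add: add_right gV qV rV uV)
  define e where "e = (\<lambda>i. if i = a then t else c i - t * d i)"
  have "(\<lambda>x. \<Sum>i\<in>insert a I. e i * f i x) = r"
  proof
    fix x
    have "(\<Sum>i\<in>I. e i * f i x) = (\<Sum>i\<in>I. c i * f i x - t * (d i * f i x))"
      using insert.hyps by (intro sum.cong) (auto simp: e_def algebra_simps)
    then show "(\<Sum>i\<in>insert a I. e i * f i x) = r x"
      using insert.hyps
      by (simp add: r_def g_def p_def q_def e_def sum_subtractf sum_distrib_left algebra_simps)
  qed
  then show ?case
    using rI ra by (intro exI[of _ e]) auto
qed

lemma projection_contractive:
  assumes "u \<in> V" "p \<in> V" "B p p = B u p"
  shows "B p p \<le> B u u"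
  using diff_square[OF assms(1,2)] nonneg[of "\<lambda>x. u x - p x"] assms(3) by simp

end

section \<open>Square-integrable functions on planar sets\<close>

lemma L2_integrable_mult:
  assumes "u \<in> L2 A" "v \<in> L2 A"
  shows "integrable (lebesgue_on A) (\<lambda>x. u x * v x)"
proof (rule Bochner_Integration.integrable_bound)
  show "integrable (lebesgue_on A) (\<lambda>x. (u x)\<^sup>2 + (v x)\<^sup>2)"
    using assms by (auto simp: L2_def)
  show "(\<lambda>x. u x * v x) \<in> borel_measurable (lebesgue_on A)"
    using assms by (auto simp: L2_def)
  have "\<bar>a * b\<bar> \<le> a\<^sup>2 + b\<^sup>2" for a b :: real
    using sum_squares_bound[of "\<bar>a\<bar>" "\<bar>b\<bar>"] mult_nonneg_nonneg[of "\<bar>a\<bar>" "\<bar>b\<bar>"]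
    unfolding abs_mult power2_abs by linarith
  then show "AE x in lebesgue_on A. norm (u x * v x) \<le> norm ((u x)\<^sup>2 + (v x)\<^sup>2)"
    by simp
qed

lemma L2_add: "u \<in> L2 A \<Longrightarrow> v \<in> L2 A \<Longrightarrow> (\<lambda>x. u x + v x) \<in> L2 A"
  using L2_integrable_mult[of u A v] by (auto simp: L2_def power2_sum mult.assoc)

lemma L2_scale: "u \<in> L2 A \<Longrightarrow> (\<lambda>x. a * u x) \<in> L2 A"
  by (auto simp: L2_def power_mult_distrib)

lemma L2_zero: "(\<lambda>x. 0) \<in> L2 A"
  by (simp add: L2_def)

lemma L2_sum: "(\<And>i. i \<in> I \<Longrightarrow> f i \<in> L2 A) \<Longrightarrow> (\<lambda>x. \<Sum>i\<in>I. f i x) \<in> L2 A"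
  by (induction I rule: infinite_finite_induct) (auto intro: L2_add L2_zero)

lemma L2_cong:
  assumes "\<And>x. x \<in> A \<Longrightarrow> u x = v x"
  shows "u \<in> L2 A \<longleftrightarrow> v \<in> L2 A"
proof -
  have "u \<in> borel_measurable (lebesgue_on A) \<longleftrightarrow> v \<in> borel_measurable (lebesgue_on A)"
    by (rule measurable_cong) (simp add: assms)
  moreover have "integrable (lebesgue_on A) (\<lambda>x. (u x)\<^sup>2) \<longleftrightarrow> integrable (lebesgue_on A) (\<lambda>x. (v x)\<^sup>2)"
    by (rule Bochner_Integration.integrable_cong) (simp_all add: assms)
  ultimately show ?thesis by (simp add: L2_def)
qed

lemma L2_inner_cong:
  "(\<And>x. x \<in> A \<Longrightarrow> u x = u' x) \<Longrightarrow> (\<And>x. x \<in> A \<Longrightarrow> v x = v' x) \<Longrightarrow>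
    L2_inner A u v = L2_inner A u' v'"
  unfolding L2_inner_def by (rule Bochner_Integration.integral_cong) auto

lemma L2_inner_commute: "L2_inner A u v = L2_inner A v u"
  by (simp add: L2_inner_def mult.commute)

lemma L2_inner_add_left:
  "u \<in> L2 A \<Longrightarrow> v \<in> L2 A \<Longrightarrow> w \<in> L2 A \<Longrightarrow>
    L2_inner A (\<lambda>x. u x + v x) w = L2_inner A u w + L2_inner A v w"
  by (simp add: L2_inner_def distrib_right L2_integrable_mult)

lemma L2_inner_scale_left: "L2_inner A (\<lambda>x. a * u x) w = a * L2_inner A u w"
  by (simp add: L2_inner_def mult.assoc)

lemma L2_inner_nonneg: "L2_inner A u u \<ge> 0"
  by (simp add: L2_inner_def integral_nonneg_AE)

lemma L2_inner_self_eq_0_AE: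
  assumes "u \<in> L2 A" "L2_inner A u u = 0"
  shows "AE x in lebesgue_on A. u x = 0"
  using assms integral_nonneg_eq_0_iff_AE[OF L2_integrable_mult[OF assms(1,1)]]
  by (simp add: L2_inner_def)

lemma L2_inner_eq_lebesgue:
  "A \<in> sets lebesgue \<Longrightarrow> L2_inner A u v = (LINT x|lebesgue. indicator A x * (u x * v x))"
  by (simp add: L2_inner_def integral_restrict_space)

lemma L2_iff_lebesgue:
  assumes "A \<in> sets lebesgue"
  shows "u \<in> L2 A \<longleftrightarrow> (\<lambda>x. indicator A x * u x) \<in> borel_measurable lebesgue \<and>
    integrable lebesgue (\<lambda>x. indicator A x * (u x)\<^sup>2)"
  using assms by (simp add: L2_def integrable_restrict_space borel_measurable_restrict_space_iff)

lemma L2_indicator_mult: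
  assumes "u \<in> L2 A" "E \<inter> A \<in> sets lebesgue" "A \<in> sets lebesgue"
  shows "(\<lambda>x. indicator E x * u x) \<in> L2 A"
proof -
  have m: "(\<lambda>x. indicator E x :: real) \<in> borel_measurable (lebesgue_on A)"
    using assms(2,3) by (auto simp: borel_measurable_indicator_iff sets_restrict_space_iff Int_commute)
  have "(\<lambda>x. indicator E x * u x) \<in> borel_measurable (lebesgue_on A)"
    using assms(1) m by (auto simp: L2_def)
  moreover have "integrable (lebesgue_on A) (\<lambda>x. (indicator E x * u x)\<^sup>2)"
  proof (rule Bochner_Integration.integrable_bound)
    show "integrable (lebesgue_on A) (\<lambda>x. (u x)\<^sup>2)"
      using assms by (simp add: L2_def)
    show "(\<lambda>x. (indicator E x * u x)\<^sup>2) \<in> borel_measurable (lebesgue_on A)"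
      using calculation by measurable
  qed (auto simp: indicator_def)
  ultimately show ?thesis by (simp add: L2_def)
qed

text \<open>
  On the null set \<open>A - E\<close> nothing is known about \<open>u\<close>; its measurability on \<open>A\<close> relies on the
  completeness of Lebesgue measure.
\<close>

lemma L2_almost_subset:
  assumes A: "A \<in> sets lebesgue" and E: "E \<in> sets lebesgue"
    and null: "A - E \<in> null_sets lebesgue" and u: "u \<in> L2 E"
  shows "u \<in> L2 A"
proof -
  have ae: "AE x in lebesgue. x \<notin> A - E"
    using null by (rule AE_not_in)
  have uE: "(\<lambda>x. indicator E x * u x) \<in> borel_measurable lebesgue"
    "integrable lebesgue (\<lambda>x. indicator E x * (u x)\<^sup>2)"
    using u E by (auto simp: L2_iff_lebesgue)
  have iA: "(indicator A :: _ \<Rightarrow> real) \<in> borel_measurable lebesgue"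
    using A by simp
  have "(\<lambda>x. indicator A x * (indicator E x * u x)) \<in> borel_measurable lebesgue"
    by (rule borel_measurable_times[OF iA uE(1)])
  moreover have "AE x in lebesgue. indicator A x * (indicator E x * u x) = indicator A x * u x"
    using ae by eventually_elim (auto simp: indicator_def)
  ultimately have 1: "(\<lambda>x. indicator A x * u x) \<in> borel_measurable lebesgue"
    by (rule borel_measurable_AE)
  have "(\<lambda>x. (indicator A x * u x)\<^sup>2) = (\<lambda>x. indicator A x * (u x)\<^sup>2)"
    by (auto simp: indicator_def fun_eq_iff)
  then have m: "(\<lambda>x. indicator A x * (u x)\<^sup>2) \<in> borel_measurable lebesgue"
    using borel_measurable_power[OF 1, of 2] by simp
  have "integrable lebesgue (\<lambda>x. indicator A x * (u x)\<^sup>2)"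
  proof (rule Bochner_Integration.integrable_bound[OF uE(2) m])
    show "AE x in lebesgue. norm (indicator A x * (u x)\<^sup>2) \<le> norm (indicator E x * (u x)\<^sup>2)"
      using ae by eventually_elim (auto simp: indicator_def)
  qed
  with 1 show ?thesis using A by (simp add: L2_iff_lebesgue)
qed

section \<open>Polynomials in two variables\<close>

lemma finite_total_degree_le: "finite {(a, b). a + b \<le> (N::nat)}"
  by (rule finite_subset[of _ "{..N} \<times> {..N}"]) auto

lemma poly_fun_eq_sum_monomials:
  "poly_fun N c z = (\<Sum>i\<in>{(a, b). a + b \<le> N}. case_prod c i * (fst z ^ fst i * snd z ^ snd i))"
  by (cases z) (simp add: poly_fun_def case_prod_beta mult.assoc)

lemma continuous_on_poly_fun: "continuous_on S (poly_fun N c)"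
  unfolding poly_fun_eq_sum_monomials[abs_def] by (intro continuous_intros)

lemma poly_fun_diff: "poly_fun N c z - poly_fun N d z = poly_fun N (\<lambda>a b. c a b - d a b) z"
  by (simp add: poly_fun_eq_sum_monomials sum_subtractf[symmetric] case_prod_beta algebra_simps)

lemma poly_fun_eq_sum_powers_snd:
  "poly_fun N c (x, y) = (\<Sum>b\<le>N. (\<Sum>a\<le>N - b. c a b * x ^ a) * y ^ b)"
proof -
  have "poly_fun N c (x, y) = (\<Sum>(b, a)\<in>(SIGMA b:{..N}. {..N - b}). c a b * x ^ a * y ^ b)"
    unfolding poly_fun_def prod.case
    by (rule sum.reindex_bij_witness[of _ prod.swap prod.swap]) auto
  also have "\<dots> = (\<Sum>b\<le>N. \<Sum>a\<le>N - b. c a b * x ^ a * y ^ b)"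
    by (subst sum.Sigma) auto
  finally show ?thesis by (simp add: sum_distrib_right)
qed

text \<open>
  Fubini: if the coefficient polynomial of \<open>y\<^sup>b\<close> does not vanish at \<open>x\<close>, the zero set meets
  the vertical line over \<open>x\<close> in finitely many points, and only finitely many \<open>x\<close> are exceptional.
\<close>

lemma null_sets_poly_fun_zeros:
  assumes "a + b \<le> N" "c a b \<noteq> 0"
  shows "{z. poly_fun N c z = 0} \<in> null_sets lebesgue"
proof -
  let ?Z = "{z. poly_fun N c z = 0}"
  let ?bad = "{x. (\<Sum>i\<le>N - b. c i b * x ^ i) = 0}"
  have "closed ?Z"
    using continuous_closed_preimage_constant[OF continuous_on_poly_fun closed_UNIV, of N c 0] by simp
  then have Z: "?Z \<in> sets borel" by (rule borel_closed)
  have "finite ?bad"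
    using assms by (intro polyfun_roots_finite[of "\<lambda>i. c i b" a]) auto
  then have "AE x in lborel. x \<notin> ?bad"
    by (intro AE_not_in finite_imp_null_set_lborel)
  then have "AE x in lborel. emeasure lborel (Pair x -` ?Z) = 0"
  proof eventually_elim
    case (elim x)
    have "finite {y. (\<Sum>b\<le>N. (\<Sum>a\<le>N - b. c a b * x ^ a) * y ^ b) = 0}"
      using elim assms by (intro polyfun_roots_finite[of "\<lambda>b. \<Sum>a\<le>N - b. c a b * x ^ a" b]) auto
    then have "finite (Pair x -` ?Z)"
      by (simp add: vimage_def poly_fun_eq_sum_powers_snd)
    then show ?case
      using finite_imp_null_set_lborel by blast
  qed
  then have "(\<integral>\<^sup>+x. emeasure lborel (Pair x -` ?Z) \<partial>lborel) = (\<integral>\<^sup>+x. 0 \<partial>(lborel :: real measure))"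
    by (intro nn_integral_cong_AE) auto
  moreover have "?Z \<in> sets (lborel \<Otimes>\<^sub>M lborel)"
    using Z by (subst lborel_prod) simp
  ultimately have "emeasure lborel ?Z = 0"
    using lborel.emeasure_pair_measure_alt[of ?Z lborel] by (simp add: lborel_prod)
  then show ?thesis
    using Z by (intro null_sets_completionI) (auto simp: null_sets_def)
qed

lemma poly_fun_AE_zero_imp_zero:
  assumes A: "A \<in> sets lebesgue" "emeasure lebesgue A > 0"
    and ae: "AE x in lebesgue_on A. poly_fun N c x = 0"
  shows "poly_fun N c = (\<lambda>x. 0)"
proof -
  have "c a b = 0" if ab: "a + b \<le> N" for a b
  proof (rule ccontr)
    assume "c a b \<noteq> 0"
    then have "AE x in lebesgue. x \<notin> {z. poly_fun N c z = 0}"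
      using ab by (intro AE_not_in null_sets_poly_fun_zeros)
    moreover have "AE x in lebesgue. x \<in> A \<longrightarrow> poly_fun N c x = 0"
      using ae A by (simp add: AE_restrict_space_iff)
    ultimately have "AE x in lebesgue. x \<notin> A"
      by eventually_elim auto
    then have "A \<in> null_sets lebesgue"
      using A(1) by (simp add: AE_iff_null_sets)
    then show False using A(2) by auto
  qed
  then show ?thesis
    by (auto simp: poly_fun_eq_sum_monomials fun_eq_iff intro!: sum.neutral)
qed

lemma poly_fun_L2_bounded:
  assumes "A \<in> sets lebesgue" "bounded A"
  shows "poly_fun N c \<in> L2 A"
proof -
  interpret finite_measure "lebesgue_on A"
    using assms by (intro finite_measure_lebesgue_on bounded_set_imp_lmeasurable)
  have b: "poly_fun N c \<in> borel_measurable borel"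
    by (intro borel_measurable_continuous_onI continuous_on_poly_fun)
  then have m: "poly_fun N c \<in> borel_measurable (lebesgue_on A)"
    by (intro measurable_restrict_space1 measurable_completion) simp
  have "compact (closure A)" using assms by (simp add: compact_closure)
  then have "bounded (poly_fun N c ` closure A)"
    by (intro compact_imp_bounded compact_continuous_image continuous_on_poly_fun)
  then obtain K where K: "\<And>x. x \<in> A \<Longrightarrow> \<bar>poly_fun N c x\<bar> \<le> K"
    unfolding bounded_iff using closure_subset[of A] by fastforce
  have "integrable (lebesgue_on A) (\<lambda>x. (poly_fun N c x)\<^sup>2)"
  proof (rule integrable_const_bound[of _ "K\<^sup>2"])
    have "(poly_fun N c x)\<^sup>2 \<le> K\<^sup>2" if "x \<in> A" for x
      using power_mono[OF K[OF that], of 2] by simp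
    then show "AE x in lebesgue_on A. norm ((poly_fun N c x)\<^sup>2) \<le> K\<^sup>2"
      by (intro AE_I2) simp
  qed (use m in simp)
  with m show ?thesis by (simp add: L2_def)
qed

section \<open>The merge projections\<close>

locale merged_mesh =
  fixes \<Omega> :: "plane set" and n :: nat and D :: "nat \<Rightarrow> plane set" and M :: "nat \<Rightarrow> nat set"
  assumes open_domain: "open \<Omega>" and bounded_domain: "bounded \<Omega>"
    and decomposition: "decomposition \<Omega> n D"
    and neighborhoods: "merge_neighborhoods n M"
begin

abbreviation weight :: "nat \<Rightarrow> real" where
  "weight k \<equiv> 1 / real (card (contributions n M k))"

lemma domain_sets: "\<Omega> \<in> sets lebesgue"
  using open_domain by (simp add: borel_open)

lemma element_sets: "k \<in> {1..n} \<Longrightarrow> D k \<in> sets lebesgue"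
  and element_pos: "k \<in> {1..n} \<Longrightarrow> emeasure lebesgue (D k) > 0"
  using decomposition unfolding decomposition_def by blast+

lemma element_almost_subset: "k \<in> {1..n} \<Longrightarrow> D k - \<Omega> \<in> null_sets lebesgue"
  using decomposition element_sets[of k] domain_sets unfolding decomposition_def
  by (elim conjE) (rule null_sets_subset[of "sym_diff \<Omega> (\<Union>k\<in>{1..n}. D k)"], auto)

lemma L2_element: "k \<in> {1..n} \<Longrightarrow> u \<in> L2 \<Omega> \<Longrightarrow> u \<in> L2 (D k)"
  using L2_almost_subset[OF element_sets domain_sets element_almost_subset] by blast

lemma poly_fun_L2_domain: "poly_fun N c \<in> L2 \<Omega>"
  by (intro poly_fun_L2_bounded domain_sets bounded_domain)

lemma self_mem: "k \<in> {1..n} \<Longrightarrow> k \<in> M k"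
  and neighborhood_subset: "k \<in> {1..n} \<Longrightarrow> M k \<subseteq> {1..n}"
  using neighborhoods by (auto simp: merge_neighborhoods_def)

lemma finite_neighborhood: "k \<in> {1..n} \<Longrightarrow> finite (M k)"
  using neighborhood_subset by (rule finite_subset) auto

lemma finite_contributions: "finite (contributions n M k)"
  by (simp add: contributions_def)

lemma card_contributions_pos: "k \<in> {1..n} \<Longrightarrow> card (contributions n M k) > 0"
  using self_mem[of k] by (auto simp: card_gt_0_iff finite_contributions contributions_def)

lemma weighted_semi_inner_space:
  assumes k: "k \<in> {1..n}"
  shows "semi_inner_space {u. \<forall>j\<in>M k. u \<in> L2 (D j)} (weighted_inner n D M k)"
proof
  fix f g h :: "plane \<Rightarrow> real" and a :: real
  let ?V = "{u. \<forall>j\<in>M k. u \<in> L2 (D j)}"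
  show "f \<in> ?V \<Longrightarrow> g \<in> ?V \<Longrightarrow> (\<lambda>x. f x + g x) \<in> ?V"
    by (simp add: L2_add)
  show "f \<in> ?V \<Longrightarrow> (\<lambda>x. a * f x) \<in> ?V"
    by (simp add: L2_scale)
  show "(\<lambda>x. 0) \<in> ?V"
    by (simp add: L2_zero)
  show "weighted_inner n D M k f g = weighted_inner n D M k g f"
    unfolding weighted_inner_def by (subst L2_inner_commute) (rule refl)
  show "weighted_inner n D M k (\<lambda>x. f x + g x) h = weighted_inner n D M k f h + weighted_inner n D M k g h"
    if "f \<in> ?V" "g \<in> ?V" "h \<in> ?V"
    unfolding weighted_inner_def sum.distrib[symmetric]
    using that by (intro sum.cong refl) (simp add: L2_inner_add_left distrib_left add_divide_distrib)
  show "weighted_inner n D M k (\<lambda>x. a * f x) h = a * weighted_inner n D M k f h"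
    unfolding weighted_inner_def sum_distrib_left L2_inner_scale_left
    by (intro sum.cong refl) simp
  show "weighted_inner n D M k f f \<ge> 0"
    unfolding weighted_inner_def by (intro sum_nonneg mult_nonneg_nonneg L2_inner_nonneg) simp
qed

lemma weighted_inner_restrict_left:
  "weighted_inner n D M k (restrict f (merged D M k)) v = weighted_inner n D M k f v"
  unfolding weighted_inner_def
  by (intro sum.cong refl arg_cong2[where f="(*)"] L2_inner_cong) (auto simp: merged_def)

lemma weighted_inner_restrict_right:
  "weighted_inner n D M k v (restrict f (merged D M k)) = weighted_inner n D M k v f"
  unfolding weighted_inner_def
  by (intro sum.cong refl arg_cong2[where f="(*)"] L2_inner_cong) (auto simp: merged_def)

lemma weighted_inner_poly_fun_definite:
  assumes k: "k \<in> {1..n}" and 0: "weighted_inner n D M k (poly_fun N c) (poly_fun N c) = 0"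
  shows "poly_fun N c = (\<lambda>x. 0)"
proof -
  let ?t = "\<lambda>j. weight j * L2_inner (D j) (poly_fun N c) (poly_fun N c)"
  have "?t j \<ge> 0" for j
    by (intro mult_nonneg_nonneg L2_inner_nonneg) simp
  then have "\<forall>j\<in>M k. ?t j = 0"
    using 0 sum_nonneg_eq_0_iff[OF finite_neighborhood[OF k], of ?t]
    unfolding weighted_inner_def by blast
  then have "?t k = 0"
    using self_mem[OF k] by blast
  then have "L2_inner (D k) (poly_fun N c) (poly_fun N c) = 0"
    using card_contributions_pos[OF k] by auto
  then show ?thesis
    using k by (intro poly_fun_AE_zero_imp_zero[of "D k"] L2_inner_self_eq_0_AE
        L2_element poly_fun_L2_domain element_sets element_pos)
qed

text \<open>
  A solution is the restriction of a combination of monomials with the required weighted products.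
  Two solutions have equal weighted
  products with every polynomial, so their difference is a polynomial that is orthogonal to itself,
  hence zero everywhere; on \<open>merged D M k\<close> the solutions agree at every point.
\<close>

lemma merge_projection_characterization:
  assumes k: "k \<in> {1..n}" and u: "u \<in> L2 \<Omega>"
  shows "merge_projection N n D M k u \<in> poly_space N (merged D M k) \<and>
    (\<forall>v\<in>poly_space N (merged D M k).
       weighted_inner n D M k (merge_projection N n D M k u) v = weighted_inner n D M k u v)"
proof -
  let ?P = "\<lambda>p. p \<in> poly_space N (merged D M k) \<and>
        (\<forall>v\<in>poly_space N (merged D M k). weighted_inner n D M k p v = weighted_inner n D M k u v)"
  let ?V = "{u. \<forall>j\<in>M k. u \<in> L2 (D j)}"
  let ?B = "weighted_inner n D M k"
  interpret semi_inner_space ?V ?B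
    using k by (rule weighted_semi_inner_space)
  let ?I = "{(a, b). a + b \<le> N}"
  let ?m = "\<lambda>i (z::plane). fst z ^ fst i * snd z ^ snd i"
  have in_V: "f \<in> L2 \<Omega> \<Longrightarrow> f \<in> ?V" for f
    using neighborhood_subset[OF k] L2_element by blast
  have polyV: "poly_fun N c \<in> ?V" for c
    by (intro in_V poly_fun_L2_domain)
  have mV: "?m i \<in> ?V" if "i \<in> ?I" for i
  proof -
    have "poly_fun N (\<lambda>a b. if (a, b) = i then 1 else 0) z = ?m i z" for z
    proof -
      have "poly_fun N (\<lambda>a b. if (a, b) = i then 1 else 0) z = (\<Sum>l\<in>?I. if l = i then ?m i z else 0)"
        unfolding poly_fun_eq_sum_monomials by (intro sum.cong) auto
      also have "\<dots> = ?m i z"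
        using that finite_total_degree_le[of N] by (simp only: sum.delta if_True)
      finally show ?thesis .
    qed
    then have "?m i = poly_fun N (\<lambda>a b. if (a, b) = i then 1 else 0)"
      by presburger
    then show ?thesis by (simp only: polyV)
  qed
  obtain c where c: "\<forall>j\<in>?I. ?B (\<lambda>x. \<Sum>i\<in>?I. c i * ?m i x) (?m j) = ?B u (?m j)"
    using projection_onto_span_exists[of ?I ?m u, OF finite_total_degree_le mV in_V[OF u]] by blast
  define p where "p = poly_fun N (curry c)"
  have pV: "p \<in> ?V"
    unfolding p_def by (rule polyV)
  have p_eq: "p = (\<lambda>x. \<Sum>i\<in>?I. c i * ?m i x)"
    by (simp add: p_def poly_fun_eq_sum_monomials fun_eq_iff)
  have expand: "?B w (poly_fun N d) = (\<Sum>i\<in>?I. case_prod d i * ?B w (?m i))" if "w \<in> ?V" for w d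
    using sum_left[of ?I "\<lambda>i x. case_prod d i * ?m i x" w, OF scale_closed[OF mV] that]
    unfolding poly_fun_eq_sum_monomials[abs_def] by (simp add: commute[of w] scale_left)
  have p_orth: "?B p (poly_fun N d) = ?B u (poly_fun N d)" for d
    unfolding expand[OF in_V[OF u]] expand[OF pV]
    using c unfolding p_eq by (intro sum.cong refl arg_cong2[where f="(*)"]) blast
  have "\<exists>!p. ?P p"
  proof (rule ex_ex1I)
    show "\<exists>p. ?P p"
      using p_orth
      by (intro exI[of _ "restrict p (merged D M k)"])
        (auto simp: poly_space_def p_def weighted_inner_restrict_left weighted_inner_restrict_right)
  next
    fix q r assume q: "?P q" and r: "?P r"
    obtain a where a: "q = restrict (poly_fun N a) (merged D M k)"
      using q by (auto simp: poly_space_def)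
    obtain b where b: "r = restrict (poly_fun N b) (merged D M k)"
      using r by (auto simp: poly_space_def)
    have *: "?B (poly_fun N a) (poly_fun N d) = ?B (poly_fun N b) (poly_fun N d)" for d
    proof -
      have "restrict (poly_fun N d) (merged D M k) \<in> poly_space N (merged D M k)"
        by (auto simp: poly_space_def)
      then have "?B q (restrict (poly_fun N d) (merged D M k)) = ?B r (restrict (poly_fun N d) (merged D M k))"
        using q r by simp
      then show ?thesis
        by (simp add: a b weighted_inner_restrict_left weighted_inner_restrict_right)
    qed
    let ?d = "poly_fun N (\<lambda>i j. a i j - b i j)"
    have "?B ?d ?d = ?B (poly_fun N a) ?d - ?B (poly_fun N b) ?d"
      using diff_left[OF polyV polyV polyV] by (simp add: poly_fun_diff)
    then have "?d = (\<lambda>x. 0)"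
      using * k by (intro weighted_inner_poly_fun_definite) auto
    then have "poly_fun N a = poly_fun N b"
      by (simp add: fun_eq_iff poly_fun_diff[symmetric])
    then show "q = r" by (simp add: a b)
  qed
  then show ?thesis
    unfolding merge_projection_def by (rule theI')
qed

lemma merge_projection_polynomial:
  assumes "k \<in> {1..n}" "u \<in> L2 \<Omega>"
  obtains c where "\<And>x. x \<in> merged D M k \<Longrightarrow> merge_projection N n D M k u x = poly_fun N c x"
  using merge_projection_characterization[OF assms, of N] by (auto simp: poly_space_def)

lemma merge_projection_L2:
  assumes "k \<in> {1..n}" "u \<in> L2 \<Omega>" "j \<in> M k"
  shows "merge_projection N n D M k u \<in> L2 (D j)"
proof -
  obtain c where "\<And>x. x \<in> merged D M k \<Longrightarrow> merge_projection N n D M k u x = poly_fun N c x"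
    using merge_projection_polynomial assms(1,2) by metis
  then have "merge_projection N n D M k u \<in> L2 (D j) \<longleftrightarrow> poly_fun N c \<in> L2 (D j)"
    using assms(3) by (intro L2_cong) (auto simp: merged_def)
  then show ?thesis
    using neighborhood_subset[OF assms(1)] assms(3) L2_element poly_fun_L2_domain by blast
qed

lemma merge_projection_contractive:
  assumes k: "k \<in> {1..n}" and u: "u \<in> L2 \<Omega>"
  shows "weighted_inner n D M k (merge_projection N n D M k u) (merge_projection N n D M k u)
    \<le> weighted_inner n D M k u u"
proof -
  interpret semi_inner_space "{u. \<forall>j\<in>M k. u \<in> L2 (D j)}" "weighted_inner n D M k"
    using k by (rule weighted_semi_inner_space)
  show ?thesis
    using merge_projection_characterization[OF k u, of N] merge_projection_L2[OF k u]
      neighborhood_subset[OF k] L2_element[OF _ u]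
    by (intro projection_contractive) auto
qed

section \<open>Contractivity\<close>

lemma L2_inner_sum_elements:
  assumes f: "f \<in> L2 \<Omega>"
  shows "L2_inner \<Omega> f f = (\<Sum>k\<in>{1..n}. L2_inner (D k) f f)"
proof -
  have int: "integrable lebesgue (\<lambda>x. indicator A x * (f x * f x))"
    if "A \<in> sets lebesgue" "f \<in> L2 A" for A
    using that L2_iff_lebesgue[of A f] by (simp add: power2_eq_square)
  let ?overlap = "\<Union>j\<in>{1..n}. \<Union>k\<in>{1..n} - {j}. D j \<inter> D k"
  have "?overlap \<in> null_sets lebesgue"
    using decomposition by (intro null_sets.finite_UN) (auto simp: decomposition_def)
  then have "AE x in lebesgue. x \<notin> ?overlap"
    by (rule AE_not_in)
  moreover have "AE x in lebesgue. x \<notin> sym_diff \<Omega> (\<Union>k\<in>{1..n}. D k)"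
    using decomposition by (intro AE_not_in) (simp add: decomposition_def)
  ultimately have ae: "AE x in lebesgue. indicator \<Omega> x * (f x * f x) =
      (\<Sum>k\<in>{1..n}. indicator (D k) x * (f x * f x))"
  proof eventually_elim
    case (elim x)
    show ?case
    proof (cases "x \<in> \<Omega>")
      case True
      then obtain k where k: "k \<in> {1..n}" "x \<in> D k"
        using elim(2) by blast
      have "x \<notin> D j" if "j \<in> {1..n}" "j \<noteq> k" for j
        using elim(1) k that by blast
      then have "(\<Sum>j\<in>{1..n}. indicator (D j) x * (f x * f x)) = (\<Sum>j\<in>{1..n}. if j = k then f x * f x else 0)"
        using k by (intro sum.cong) (simp_all add: indicator_def)
      also have "\<dots> = f x * f x"
        using k by (simp only: sum.delta finite_atLeastAtMost if_True)
      finally show ?thesis using True by simp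
    next
      case False
      then have "x \<notin> D j" if "j \<in> {1..n}" for j
        using elim(2) that by blast
      then have "(\<Sum>j\<in>{1..n}. indicator (D j) x * (f x * f x)) = 0"
        by (intro sum.neutral) simp
      then show ?thesis using False by simp
    qed
  qed
  have i1: "integrable lebesgue (\<lambda>x. indicator \<Omega> x * (f x * f x))"
    using domain_sets f by (rule int)
  have i2: "\<And>k. k \<in> {1..n} \<Longrightarrow> integrable lebesgue (\<lambda>x. indicator (D k) x * (f x * f x))"
    using int element_sets L2_element[OF _ f] by blast
  have "L2_inner \<Omega> f f = (LINT x|lebesgue. (\<Sum>k\<in>{1..n}. indicator (D k) x * (f x * f x)))"
    unfolding L2_inner_eq_lebesgue[OF domain_sets]
  proof (rule integral_cong_AE[OF _ _ ae])
    show "(\<lambda>x. indicator \<Omega> x * (f x * f x)) \<in> borel_measurable lebesgue"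
      using i1 by (rule borel_measurable_integrable)
    show "(\<lambda>x. \<Sum>k\<in>{1..n}. indicator (D k) x * (f x * f x)) \<in> borel_measurable lebesgue"
      using i2 by (intro borel_measurable_integrable Bochner_Integration.integrable_sum)
  qed
  also have "\<dots> = (\<Sum>k\<in>{1..n}. L2_inner (D k) f f)"
    by (simp only: Bochner_Integration.integral_sum[OF i2] L2_inner_eq_lebesgue element_sets cong: sum.cong)
  finally show ?thesis .
qed

lemma redistributed_L2:
  assumes k: "k \<in> {1..n}" and u: "u \<in> L2 \<Omega>"
  shows "redistributed N n D M k u \<in> L2 (D k)"
proof -
  have "(\<lambda>x. weight k * (\<Sum>j\<in>contributions n M k. merge_projection N n D M j u x)) \<in> L2 (D k)"
    using u by (intro L2_scale L2_sum merge_projection_L2) (auto simp: contributions_def)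
  then show ?thesis by (simp add: redistributed_def[abs_def])
qed

text \<open>
  Where elements overlap, the value of \<open>state_redistribution\<close> is a sum of several elementwise
  values. Each of them is polynomial on its element, so the function is everywhere a finite
  sum of indicators times polynomials.
\<close>

lemma state_redistribution_L2:
  assumes u: "u \<in> L2 \<Omega>"
  shows "state_redistribution N n D M u \<in> L2 \<Omega>"
proof -
  have "\<forall>j\<in>{1..n}. \<exists>c. \<forall>x\<in>merged D M j. merge_projection N n D M j u x = poly_fun N c x"
    using merge_projection_polynomial[OF _ u] by metis
  then obtain c where c: "\<forall>j\<in>{1..n}. \<forall>x\<in>merged D M j. merge_projection N n D M j u x = poly_fun N (c j) x"
    by metis
  let ?g = "\<lambda>x. \<Sum>k\<in>{1..n}. indicator (D k) x *
      (weight k * (\<Sum>j\<in>contributions n M k. poly_fun N (c j) x))"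
  have "?g \<in> L2 \<Omega>"
    using element_sets domain_sets
    by (intro L2_sum L2_indicator_mult L2_scale poly_fun_L2_domain) auto
  moreover have "state_redistribution N n D M u = ?g"
  proof
    fix x
    show "state_redistribution N n D M u x = ?g x"
      unfolding state_redistribution_def redistributed_def
    proof (intro sum.cong refl)
      fix k assume "k \<in> {1..n}"
      show "indicator (D k) x * (weight k * (\<Sum>j\<in>contributions n M k. merge_projection N n D M j u x)) =
        indicator (D k) x * (weight k * (\<Sum>j\<in>contributions n M k. poly_fun N (c j) x))"
      proof (cases "x \<in> D k")
        case True
        then have "(\<Sum>j\<in>contributions n M k. merge_projection N n D M j u x) =
            (\<Sum>j\<in>contributions n M k. poly_fun N (c j) x)"
          using c by (intro sum.cong) (auto simp: contributions_def merged_def)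
        then show ?thesis by simp
      qed simp
    qed
  qed
  ultimately show ?thesis by (simp only:)
qed

text \<open>The square of a mean is at most the mean of the squares, integrated over \<open>D k\<close>.\<close>

lemma L2_inner_redistributed_le:
  assumes k: "k \<in> {1..n}" and u: "u \<in> L2 \<Omega>"
  shows "L2_inner (D k) (redistributed N n D M k u) (redistributed N n D M k u) \<le>
    (\<Sum>j\<in>contributions n M k. weight k *
       L2_inner (D k) (merge_projection N n D M j u) (merge_projection N n D M j u))"
proof -
  let ?C = "contributions n M k"
  let ?P = "\<lambda>j. merge_projection N n D M j u"
  have P: "?P j \<in> L2 (D k)" if "j \<in> ?C" for j
    using that u by (intro merge_projection_L2) (auto simp: contributions_def)
  have c: "real (card ?C) > 0"
    using card_contributions_pos[OF k] by simp
  have "redistributed N n D M k u x * redistributed N n D M k u x \<le> (\<Sum>j\<in>?C. weight k * (?P j x * ?P j x))" for x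
  proof -
    have "(\<Sum>j\<in>?C. ?P j x)\<^sup>2 \<le> card ?C * (\<Sum>j\<in>?C. (?P j x)\<^sup>2)"
      using sum_squared_le_sum_of_squares[of "\<lambda>j. ?P j x" ?C] by (simp add: mult.commute)
    then have "(weight k)\<^sup>2 * (\<Sum>j\<in>?C. ?P j x)\<^sup>2 \<le> (weight k)\<^sup>2 * (card ?C * (\<Sum>j\<in>?C. (?P j x)\<^sup>2))"
      by (rule mult_left_mono) simp
    also have "\<dots> = weight k * (\<Sum>j\<in>?C. (?P j x)\<^sup>2)"
      using c by (simp add: power2_eq_square)
    finally show ?thesis
      unfolding redistributed_def sum_distrib_left[symmetric]
      by (simp only: power2_eq_square mult_ac)
  qed
  then have "L2_inner (D k) (redistributed N n D M k u) (redistributed N n D M k u) \<le>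
      (LINT x|lebesgue_on (D k). (\<Sum>j\<in>?C. weight k * (?P j x * ?P j x)))"
    unfolding L2_inner_def
    using L2_integrable_mult P redistributed_L2[OF k u]
    by (intro integral_mono) auto
  also have "\<dots> = (\<Sum>j\<in>?C. weight k * L2_inner (D k) (?P j) (?P j))"
    using P unfolding L2_inner_def
    by (subst Bochner_Integration.integral_sum) (auto intro!: L2_integrable_mult)
  finally show ?thesis .
qed

text \<open>
  Double counting of the pairs with \<open>k \<in> M j\<close>, that is, \<open>j \<in> contributions n M k\<close>. It is used with
  \<open>f j\<close> the \<open>j\<close>-th projection of \<open>u\<close>, and then with \<open>u\<close> itself for every \<open>j\<close>.
\<close>

lemma sum_weighted_inner_eq:
  "(\<Sum>j\<in>{1..n}. weighted_inner n D M j (f j) (f j)) =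
    (\<Sum>k\<in>{1..n}. \<Sum>j\<in>contributions n M k. weight k * L2_inner (D k) (f j) (f j))"
proof -
  have "(\<Sum>j\<in>{1..n}. weighted_inner n D M j (f j) (f j)) =
     (\<Sum>j\<in>{1..n}. \<Sum>k\<in>{k\<in>{1..n}. k \<in> M j}. weight k * L2_inner (D k) (f j) (f j))"
    unfolding weighted_inner_def
    using neighborhood_subset by (intro sum.cong refl) blast
  also have "\<dots> = (\<Sum>k\<in>{1..n}. \<Sum>j\<in>{j\<in>{1..n}. k \<in> M j}. weight k * L2_inner (D k) (f j) (f j))"
    by (rule sum.swap_restrict) auto
  finally show ?thesis by (simp add: contributions_def)
qed

lemma state_redistribution_inner_le:
  assumes u: "u \<in> L2 \<Omega>"
  shows "L2_inner \<Omega> (state_redistribution N n D M u) (state_redistribution N n D M u) \<le> L2_inner \<Omega> u u"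
proof -
  let ?S = "state_redistribution N n D M u"
  let ?R = "\<lambda>k. redistributed N n D M k u"
  let ?P = "\<lambda>j. merge_projection N n D M j u"
  have "L2_inner (D k) ?S ?S = L2_inner (D k) (?R k) (?R k)" if k: "k \<in> {1..n}" for k
    unfolding L2_inner_def
  proof (rule integral_cong_AE)
    show "(\<lambda>x. ?S x * ?S x) \<in> borel_measurable (lebesgue_on (D k))"
      using L2_integrable_mult[OF L2_element[OF k] L2_element[OF k]] state_redistribution_L2[OF u] by blast
    show "(\<lambda>x. ?R k x * ?R k x) \<in> borel_measurable (lebesgue_on (D k))"
      using L2_integrable_mult redistributed_L2[OF k u] by blast
    show "AE x in lebesgue_on (D k). ?S x * ?S x = ?R k x * ?R k x"
      using state_redistribution_on_element[OF decomposition k, of N M u] by eventually_elim simp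
  qed
  then have "L2_inner \<Omega> ?S ?S = (\<Sum>k\<in>{1..n}. L2_inner (D k) (?R k) (?R k))"
    by (simp add: L2_inner_sum_elements state_redistribution_L2 u)
  also have "\<dots> \<le> (\<Sum>k\<in>{1..n}. \<Sum>j\<in>contributions n M k. weight k * L2_inner (D k) (?P j) (?P j))"
    using u by (intro sum_mono L2_inner_redistributed_le)
  also have "\<dots> = (\<Sum>j\<in>{1..n}. weighted_inner n D M j (?P j) (?P j))"
    by (rule sum_weighted_inner_eq[symmetric])
  also have "\<dots> \<le> (\<Sum>j\<in>{1..n}. weighted_inner n D M j u u)"
    using u by (intro sum_mono merge_projection_contractive)
  also have "\<dots> = (\<Sum>k\<in>{1..n}. \<Sum>j\<in>contributions n M k. weight k * L2_inner (D k) u u)"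
    by (rule sum_weighted_inner_eq)
  also have "\<dots> = (\<Sum>k\<in>{1..n}. L2_inner (D k) u u)"
    using card_contributions_pos by (intro sum.cong) (auto dest: less_imp_neq)
  also have "\<dots> = L2_inner \<Omega> u u"
    using u by (simp add: L2_inner_sum_elements)
  finally show ?thesis .
qed

end

theorem theorem2p1:
  fixes \<Omega> :: "(real \<times> real) set" and n N :: nat
    and D :: "nat \<Rightarrow> (real \<times> real) set" and M :: "nat \<Rightarrow> nat set"
    and u :: "real \<times> real \<Rightarrow> real"
  assumes "open \<Omega>" and "connected \<Omega>" and "\<Omega> \<noteq> {}" and "bounded \<Omega>"
    and "decomposition \<Omega> n D"
    and "merge_neighborhoods n M"
    and "u \<in> L2 \<Omega>"
  shows "state_redistribution N n D M u \<in> L2 \<Omega> \<and>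
         L2_norm \<Omega> (state_redistribution N n D M u) \<le> L2_norm \<Omega> u"
proof -
  interpret merged_mesh \<Omega> n D M
    using assms by unfold_locales
  show ?thesis
    using state_redistribution_L2 state_redistribution_inner_le assms(7)
    by (simp add: L2_norm_def)
qed

end
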